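(* Let $t\in\mathbb{R}$. Then $t^2=1$ if and only if the adjoint of the realization of every hypercomplex number in $\mathbb{H}_t$ is contained in $\mathcal{H}_2^t$; that is, $$\text{either } t=1 \text{ or } t=-1\iff [\xi]_t^{*}\in\mathcal{H}_2^t\ \text{ for all }\xi\in\mathbb{H}_t.$$
   Context: For $t\in\mathbb{R}$, $\mathbb{H}_t$ is the set $\mathbb{C}^2$ with usual addition and multiplication $(a_1,b_1)\cdot_t(a_2,b_2)=(a_1a_2+tb_1\overline{b_2},\;a_1b_2+b_1\overline{a_2})$. The realization of $(a,b)\in\mathbb{H}_t$ is $[(a,b)]_t=\begin{pmatrix} a & tb\\ \overline{b} & \overline{a}\end{pmatrix}\in M_2(\mathbb{C})$, and $\mathcal{H}_2^t=\{[\xi]_t:\xi\in\mathbb{H}_t\}\subset M_2(\mathbb{C})$. For $T\in M_2(\mathbb{C})$, $T^*$ is the conjugate transpose of $T$. *)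

theory Defs
  imports "Jordan_Normal_Form.Schur_Decomposition"
begin

definition hypercomplex :: "real \<Rightarrow> (complex \<times> complex) ring" where
  "hypercomplex t =
     \<lparr>carrier = UNIV,
      monoid.mult = (\<lambda>(a\<^sub>1, b\<^sub>1) (a\<^sub>2, b\<^sub>2).
         (a\<^sub>1 * a\<^sub>2 + complex_of_real t * b\<^sub>1 * cnj b\<^sub>2, a\<^sub>1 * b\<^sub>2 + b\<^sub>1 * cnj a\<^sub>2)),
      one = (1, 0),
      zero = (0, 0),
      add = (\<lambda>(a\<^sub>1, b\<^sub>1) (a\<^sub>2, b\<^sub>2). (a\<^sub>1 + a\<^sub>2, b\<^sub>1 + b\<^sub>2))\<rparr>"

definition realization :: "real \<Rightarrow> complex \<times> complex \<Rightarrow> complex mat" where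
  "realization t = (\<lambda>(a, b).
     mat_of_rows_list 2 [[a,     complex_of_real t * b],
                         [cnj b, cnj a]])"

definition realizations :: "real \<Rightarrow> complex mat set" where
  "realizations t = realization t ` carrier (hypercomplex t)"

end

theory Submission
  imports Defs
begin

text \<open>
  The adjoint of \<open>[(a, b)]\<^sub>t\<close> has first row \<open>(cnj a, b)\<close> and second row \<open>(t * cnj b, a)\<close>. If it is
  to be a realization, its first column forces the hypercomplex number it comes from to be
  \<open>(cnj a, t * b)\<close>, because the lower left entry of a realization carries no factor \<open>t\<close>. The
  upper right entry is then the only remaining condition, and it reads \<open>t\<^sup>2 * b = b\<close>
  (\<open>mat_adjoint_realization_in_realizations_iff\<close>). This holds for all \<open>b\<close> exactly when
  \<open>t\<^sup>2 = 1\<close>, as \<open>b = 1\<close> shows.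
\<close>

lemma realization_eq_mat:
  "realization t (a, b) =
     mat 2 2 (\<lambda>(i, j). if i = 0 then (if j = 0 then a else complex_of_real t * b)
                       else (if j = 0 then cnj b else cnj a))"
  by (rule eq_matI)
     (auto simp: realization_def mat_of_rows_list_def less_2_cases_iff)

lemma mat_adjoint_realization_eq_mat:
  "mat_adjoint (realization t (a, b)) =
     mat 2 2 (\<lambda>(i, j). if i = 0 then (if j = 0 then cnj a else b)
                       else (if j = 0 then complex_of_real t * cnj b else a))"
  by (rule eq_matI)
     (auto simp: realization_eq_mat mat_adjoint_def mat_of_rows_def less_2_cases_iff)

lemma mat_2_2_eq_iff:
  "mat 2 2 f = mat 2 2 g \<longleftrightarrow>
     f (0, 0) = g (0, 0) \<and> f (0, 1) = g (0, 1) \<and> f (1, 0) = g (1, 0) \<and> f (1, 1) = g (1, 1)"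
  by (auto simp: mat_eq_iff less_2_cases_iff)

lemma mat_adjoint_realization_in_realizations_iff:
  "mat_adjoint (realization t (a, b)) \<in> realizations t \<longleftrightarrow> complex_of_real (t\<^sup>2) * b = b"
proof -
  have eq_iff: "mat_adjoint (realization t (a, b)) = realization t (c, d) \<longleftrightarrow>
      c = cnj a \<and> d = complex_of_real t * b \<and> complex_of_real t * d = b" for c d
  proof -
    have "complex_of_real t * cnj b = cnj d \<longleftrightarrow> d = complex_of_real t * b"
      by (metis complex_cnj_cnj complex_cnj_complex_of_real complex_cnj_mult)
    then show ?thesis
      unfolding mat_adjoint_realization_eq_mat
      unfolding realization_eq_mat mat_2_2_eq_iff
      by auto
  qed
  have "mat_adjoint (realization t (a, b)) \<in> realizations t \<longleftrightarrow>
      (\<exists>c d. mat_adjoint (realization t (a, b)) = realization t (c, d))"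
    by (auto simp: realizations_def hypercomplex_def)
  also have "\<dots> \<longleftrightarrow> complex_of_real (t\<^sup>2) * b = b"
    by (simp add: eq_iff power2_eq_square mult.assoc)
  finally show ?thesis .
qed

theorem theorem43:
  fixes t :: real
  shows "(t\<^sup>2 = 1 \<longleftrightarrow> (\<forall>\<xi> \<in> carrier (hypercomplex t). mat_adjoint (realization t \<xi>) \<in> realizations t)) \<and>
         ((t = 1 \<or> t = -1) \<longleftrightarrow> (\<forall>\<xi> \<in> carrier (hypercomplex t). mat_adjoint (realization t \<xi>) \<in> realizations t))"
proof -
  have "(\<forall>\<xi> \<in> carrier (hypercomplex t). mat_adjoint (realization t \<xi>) \<in> realizations t) \<longleftrightarrow>
      (\<forall>b. complex_of_real (t\<^sup>2) * b = b)"
    by (simp add: hypercomplex_def mat_adjoint_realization_in_realizations_iff del: of_real_power)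
  also have "\<dots> \<longleftrightarrow> t\<^sup>2 = 1"
    by (metis mult.right_neutral mult_1 of_real_1 of_real_eq_iff)
  finally show ?thesis
    by (simp add: power2_eq_1_iff)
qed

end
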